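(* Let $n\ge 1$ and $k > n$ be integers, let $\bm{a}_1, \ldots, \bm{a}_k \in \mathbb{R}^n$ (regarded as row vectors), and let $\bm{w} \in (0,+\infty)^k$ be a column vector. Then there are an integer $m$ with $\frac{k}{n+1} \le m \le k-n$ and column vectors $\bm{w}_1,\ldots,\bm{w}_m \in [0,+\infty)^k$ with $1 \le \|\bm{w}_i\|_0 \le n+1$ for $i = 1,\ldots,m$, such that $$\bm{w} = \bm{w}_1 + \cdots + \bm{w}_m$$ and $$\frac{\bm{w}_i^T}{\|\bm{w}_i\|_1} \begin{bmatrix} \bm{a}_1 \\ \vdots \\ \bm{a}_k \end{bmatrix} = \frac{\bm{w}^T}{\|\bm{w}\|_1} \begin{bmatrix} \bm{a}_1 \\ \vdots \\ \bm{a}_k \end{bmatrix}, \quad i = 1,\ldots,m.$$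
   Context: For a vector $\bm{x} \in \mathbb{R}^k$ with entries $x_1,\ldots,x_k$, $\|\bm{x}\|_0$ is the number of nonzero entries of $\bm{x}$ and $\|\bm{x}\|_1 = \sum_{i=1}^k |x_i|$. The bracket denotes the $k \times n$ matrix whose $s$-th row is $\bm{a}_s$. *)

theory Defs
  imports "HOL-Analysis.Analysis"
begin

definition l0_norm :: "real ^ 'k \<Rightarrow> nat" where
  "l0_norm x = card {i. x $ i \<noteq> 0}"

definition l1_norm :: "real ^ 'k \<Rightarrow> real" where
  "l1_norm x = (\<Sum>i\<in>UNIV. \<bar>x $ i\<bar>)"

definition matrix_of_rows :: "('k \<Rightarrow> real ^ 'n) \<Rightarrow> real ^ 'n ^ 'k" where
  "matrix_of_rows a = (\<chi> s. a s)"

end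

theory Submission imports Defs begin

text \<open>
  Let \<open>c\<close> be the weighted mean of the points \<open>a\<^sub>s\<close> with weights \<open>w\<close>. A nonzero nonnegative weight
  vector has the same mean exactly when it annihilates the translated points \<open>a\<^sub>s - c\<close>, a condition
  that is linear in the weights. So \<open>w\<close> has to be cut into nonnegative annihilators of small
  support.

  If the support of a nonnegative annihilator \<open>v\<close> has more than \<open>n + 1\<close> elements, then \<open>0\<close> is in the
  convex hull of the translated points indexed by it, and Caratheodory's theorem gives a nonzero nonnegative
  annihilator \<open>u\<close> on at most \<open>n + 1\<close> of these indices (\<open>caratheodory_annihilator\<close>). Subtracting
  the largest multiple of \<open>u\<close> that stays below \<open>v\<close> makes an entry of \<open>v\<close> vanish and leaves a
  nonzero remainder, since the support of \<open>v\<close> is larger than that of \<open>u\<close>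
  (\<open>split_off_small_support\<close>). As each step lowers the size of the support, at most \<open>k - n - 1\<close>
  steps bring it from \<open>k\<close> down to at most \<open>n + 1\<close>, and the last remainder is one more part: this is
  the upper bound on \<open>m\<close> (\<open>annihilator_decomposition\<close>). The lower bound holds for every
  decomposition of \<open>w\<close> into parts of support size at most \<open>n + 1\<close>, because the supports of the parts
  cover all \<open>k\<close> indices (\<open>l0_norm_sum_le\<close>).
\<close>

lemma l0_norm_ge_1_iff: "1 \<le> l0_norm x \<longleftrightarrow> x \<noteq> 0"
proof -
  have "l0_norm x = 0 \<longleftrightarrow> x = 0"
    by (auto simp: l0_norm_def vec_eq_iff)
  then show ?thesis by linarith
qed

lemma l0_norm_scaleR: "t \<noteq> 0 \<Longrightarrow> l0_norm (t *\<^sub>R x) = l0_norm x"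
  by (simp add: l0_norm_def)

lemma l0_norm_sum_le: "l0_norm (\<Sum>i\<in>I. x i) \<le> (\<Sum>i\<in>I. l0_norm (x i))"
proof (cases "finite I")
  case True
  have "{s. (\<Sum>i\<in>I. x i) $ s \<noteq> 0} \<subseteq> (\<Union>i\<in>I. {s. x i $ s \<noteq> 0})"
    by (auto simp: sum_component intro: sum.neutral)
  then have "l0_norm (\<Sum>i\<in>I. x i) \<le> card (\<Union>i\<in>I. {s. x i $ s \<noteq> 0})"
    unfolding l0_norm_def by (intro card_mono) auto
  also have "\<dots> \<le> (\<Sum>i\<in>I. l0_norm (x i))"
    unfolding l0_norm_def by (rule card_UN_le[OF True])
  finally show ?thesis .
qed (simp add: l0_norm_def)

lemma l1_norm_nonneg_eq: "(\<And>s. x $ s \<ge> 0) \<Longrightarrow> l1_norm x = (\<Sum>s\<in>UNIV. x $ s)"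
  by (simp add: l1_norm_def)

lemma l1_norm_pos: "x \<noteq> 0 \<Longrightarrow> l1_norm x > 0"
  unfolding l1_norm_def by (auto simp: vec_eq_iff sum_pos2)

lemma vector_matrix_mult_matrix_of_rows:
  "x v* matrix_of_rows a = (\<Sum>s\<in>UNIV. (x $ s) *\<^sub>R a s)"
  by (simp add: vec_eq_iff vector_matrix_mult_def matrix_of_rows_def sum_component mult.commute)

text \<open>
  Caratheodory's theorem selects points, whereas a bound on the support counts indices, and several
  indices may carry the same point. Hence one index is chosen for each selected point.
\<close>

lemma caratheodory_annihilator:
  fixes b :: "'k::finite \<Rightarrow> 'a::euclidean_space" and v :: "real ^ 'k"
  assumes nonneg: "\<And>s. v $ s \<ge> 0" and "v \<noteq> 0"
    and annihilates: "(\<Sum>s\<in>UNIV. (v $ s) *\<^sub>R b s) = 0"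
  obtains u :: "real ^ 'k" where "\<And>s. u $ s \<ge> 0" "u \<noteq> 0" "l0_norm u \<le> DIM('a) + 1"
    "(\<Sum>s\<in>UNIV. (u $ s) *\<^sub>R b s) = 0" "\<And>s. v $ s = 0 \<Longrightarrow> u $ s = 0"
proof -
  define T where "T = {s. v $ s \<noteq> 0}"
  have total: "(\<Sum>s\<in>T. v $ s) = l1_norm v"
    unfolding T_def l1_norm_nonneg_eq[OF nonneg] by (intro sum.mono_neutral_left) auto
  have "(\<Sum>s\<in>T. (v $ s) *\<^sub>R b s) = 0"
    unfolding annihilates[symmetric] T_def by (intro sum.mono_neutral_left) auto
  then have "(\<Sum>s\<in>T. (v $ s / l1_norm v) *\<^sub>R b s) = 0"
    by (simp add: divide_inverse mult.commute flip: scaleR_scaleR scaleR_right.sum)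
  moreover have "(\<Sum>s\<in>T. (v $ s / l1_norm v) *\<^sub>R b s) \<in> convex hull (b ` T)"
    using nonneg l1_norm_pos[OF \<open>v \<noteq> 0\<close>] total
    by (intro convex_sum) (auto simp: hull_inc simp flip: sum_divide_distrib)
  ultimately have "0 \<in> convex hull (b ` T)" by simp
  then obtain S where S: "finite S" "S \<subseteq> b ` T" "card S \<le> DIM('a) + 1" "0 \<in> convex hull S"
    unfolding caratheodory[of "b ` T"] by auto
  then obtain U where U: "U \<subseteq> T" "inj_on b U" "S = b ` U"
    by (auto simp: subset_image_inj)
  obtain r where r: "\<forall>x\<in>S. 0 \<le> r x" "sum r S = 1" "(\<Sum>x\<in>S. r x *\<^sub>R x) = 0"
    using S(4) by (auto simp: convex_hull_finite[OF S(1)])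
  define u :: "real ^ 'k" where "u = (\<chi> s. if s \<in> U then r (b s) else 0)"
  show ?thesis
  proof
    show "u $ s \<ge> 0" for s
      using r(1) U(3) by (simp add: u_def)
    have "(\<Sum>s\<in>U. u $ s) = 1"
      using r(2) by (simp add: u_def U(3) sum.reindex[OF U(2)])
    then show "u \<noteq> 0" by auto
    have "l0_norm u \<le> card U"
      unfolding l0_norm_def by (intro card_mono) (auto simp: u_def)
    also have "card U = card S"
      by (simp add: U(2,3) card_image)
    finally show "l0_norm u \<le> DIM('a) + 1" using S(3) by simp
    have "(\<Sum>s\<in>UNIV. (u $ s) *\<^sub>R b s) = (\<Sum>s\<in>U. r (b s) *\<^sub>R b s)"
      by (intro sum.mono_neutral_cong_right) (auto simp: u_def)
    then show "(\<Sum>s\<in>UNIV. (u $ s) *\<^sub>R b s) = 0"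
      using r(3) by (simp add: U(3) sum.reindex[OF U(2)])
    show "u $ s = 0" if "v $ s = 0" for s
      using that U(1) by (auto simp: u_def T_def)
  qed
qed

text \<open>
  The multiple of the annihilator that is split off is determined by the smallest ratio
  \<open>v\<^sub>s / u\<^sub>s\<close> over the support of \<open>u\<close>: it is the largest one that keeps the remainder nonnegative, and
  the entry where the ratio is attained vanishes in the remainder.
\<close>

lemma split_off_small_support:
  fixes b :: "'k::finite \<Rightarrow> 'a::euclidean_space" and v :: "real ^ 'k"
  assumes nonneg: "\<And>s. v $ s \<ge> 0" and large: "l0_norm v > DIM('a) + 1"
    and annihilates: "(\<Sum>s\<in>UNIV. (v $ s) *\<^sub>R b s) = 0"
  obtains u v' :: "real ^ 'k" where "v = u + v'"
    "\<And>s. u $ s \<ge> 0" "u \<noteq> 0" "l0_norm u \<le> DIM('a) + 1" "(\<Sum>s\<in>UNIV. (u $ s) *\<^sub>R b s) = 0"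
    "\<And>s. v' $ s \<ge> 0" "v' \<noteq> 0" "l0_norm v' < l0_norm v" "(\<Sum>s\<in>UNIV. (v' $ s) *\<^sub>R b s) = 0"
proof -
  have "v \<noteq> 0" using large by (auto simp flip: l0_norm_ge_1_iff)
  then obtain y :: "real ^ 'k" where y: "\<And>s. y $ s \<ge> 0" "y \<noteq> 0" "l0_norm y \<le> DIM('a) + 1"
    "(\<Sum>s\<in>UNIV. (y $ s) *\<^sub>R b s) = 0" "\<And>s. v $ s = 0 \<Longrightarrow> y $ s = 0"
    using caratheodory_annihilator[OF nonneg _ annihilates] by metis
  define R where "R = (\<lambda>s. v $ s / y $ s) ` {s. y $ s \<noteq> 0}"
  define t where "t = Min R"
  have "finite R" and "R \<noteq> {}"
    using y(2) by (auto simp: R_def vec_eq_iff)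
  then have "t \<in> R" and t_le: "\<And>q. q \<in> R \<Longrightarrow> t \<le> q"
    by (auto simp: t_def)
  then obtain p where p: "y $ p \<noteq> 0" "t = v $ p / y $ p"
    by (auto simp: R_def)
  have vp: "v $ p \<noteq> 0" using y(5) p(1) by blast
  have "t > 0"
    using p vp nonneg[of p] y(1)[of p] by (simp add: less_le)
  show ?thesis
  proof
    show "v = t *\<^sub>R y + (v - t *\<^sub>R y)" by simp
    show "(t *\<^sub>R y) $ s \<ge> 0" for s using \<open>t > 0\<close> y(1) by simp
    show "t *\<^sub>R y \<noteq> 0" using \<open>t > 0\<close> y(2) by simp
    show small: "l0_norm (t *\<^sub>R y) \<le> DIM('a) + 1"
      using \<open>t > 0\<close> y(3) by (simp add: l0_norm_scaleR)
    show uann: "(\<Sum>s\<in>UNIV. ((t *\<^sub>R y) $ s) *\<^sub>R b s) = 0"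
      using y(4) by (simp flip: scaleR_scaleR scaleR_right.sum)
    show "(v - t *\<^sub>R y) $ s \<ge> 0" for s
    proof (cases "y $ s = 0")
      case False
      then have "t \<le> v $ s / y $ s" by (intro t_le) (auto simp: R_def)
      then show ?thesis
        using False y(1)[of s] by (simp add: pos_le_divide_eq less_le)
    qed (simp add: nonneg)
    show "v - t *\<^sub>R y \<noteq> 0" using small large by auto
    show "l0_norm (v - t *\<^sub>R y) < l0_norm v"
      unfolding l0_norm_def
    proof (intro psubset_card_mono psubsetI)
      show "{s. (v - t *\<^sub>R y) $ s \<noteq> 0} \<subseteq> {s. v $ s \<noteq> 0}" using y(5) by auto
      have "(v - t *\<^sub>R y) $ p = 0" using p by simp
      then show "{s. (v - t *\<^sub>R y) $ s \<noteq> 0} \<noteq> {s. v $ s \<noteq> 0}" using vp by blast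
    qed simp
    show "(\<Sum>s\<in>UNIV. ((v - t *\<^sub>R y) $ s) *\<^sub>R b s) = 0"
      using uann annihilates by (simp add: scaleR_diff_left sum_subtractf)
  qed
qed

text \<open>
  The maximum with \<open>1\<close> makes the bound meaningful for supports of size at most \<open>n\<close>: the remainder of
  a split can have such a small support, but it is still a part of its own.
\<close>

lemma annihilator_decomposition:
  fixes b :: "'k::finite \<Rightarrow> 'a::euclidean_space" and v :: "real ^ 'k"
  assumes "\<And>s. v $ s \<ge> 0" and "v \<noteq> 0" and "(\<Sum>s\<in>UNIV. (v $ s) *\<^sub>R b s) = 0"
  shows "\<exists>m (vs :: nat \<Rightarrow> real ^ 'k). m \<le> max 1 (l0_norm v - DIM('a)) \<and> v = (\<Sum>i=1..m. vs i) \<and>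
    (\<forall>i\<in>{1..m}. (\<forall>s. vs i $ s \<ge> 0) \<and> vs i \<noteq> 0 \<and> l0_norm (vs i) \<le> DIM('a) + 1 \<and>
                 (\<Sum>s\<in>UNIV. (vs i $ s) *\<^sub>R b s) = 0)"
  using assms
proof (induction "l0_norm v" arbitrary: v rule: less_induct)
  case less
  show ?case
  proof (cases "l0_norm v > DIM('a) + 1")
    case False
    with less.prems show ?thesis
      by (intro exI[of _ 1] exI[of _ "\<lambda>_. v"]) auto
  next
    case True
    obtain u v' where uv: "v = u + v'"
      and u: "\<And>s. u $ s \<ge> 0" "u \<noteq> 0" "l0_norm u \<le> DIM('a) + 1" "(\<Sum>s\<in>UNIV. (u $ s) *\<^sub>R b s) = 0"
      and v': "\<And>s. v' $ s \<ge> 0" "v' \<noteq> 0" "l0_norm v' < l0_norm v"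
        "(\<Sum>s\<in>UNIV. (v' $ s) *\<^sub>R b s) = 0"
      by (rule split_off_small_support[OF less.prems(1) True less.prems(3)]) blast
    obtain m vs where m: "m \<le> max 1 (l0_norm v' - DIM('a))" "v' = (\<Sum>i=1..m. vs i)"
      and vs: "\<forall>i\<in>{1..m}. (\<forall>s. vs i $ s \<ge> 0) \<and> vs i \<noteq> 0 \<and> l0_norm (vs i) \<le> DIM('a) + 1 \<and>
                 (\<Sum>s\<in>UNIV. (vs i $ s) *\<^sub>R b s) = 0"
      using less.hyps[OF v'(3) v'(1,2,4)] by blast
    define vs' where "vs' = vs(Suc m := u)"
    have "Suc m \<le> max 1 (l0_norm v - DIM('a))"
      using m(1) v'(3) True by linarith
    moreover have "v = (\<Sum>i=1..Suc m. vs' i)"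
      by (simp add: uv m(2) vs'_def)
    moreover have "\<forall>i\<in>{1..Suc m}. (\<forall>s. vs' i $ s \<ge> 0) \<and> vs' i \<noteq> 0 \<and>
        l0_norm (vs' i) \<le> DIM('a) + 1 \<and> (\<Sum>s\<in>UNIV. (vs' i $ s) *\<^sub>R b s) = 0"
      using vs u by (auto simp: vs'_def le_Suc_eq)
    ultimately show ?thesis by blast
  qed
qed

lemma weighted_mean_eq_iff:
  fixes a :: "'k::finite \<Rightarrow> real ^ 'n" and x :: "real ^ 'k"
  assumes nonneg: "\<And>s. x $ s \<ge> 0" and "x \<noteq> 0"
  shows "(x /\<^sub>R l1_norm x) v* matrix_of_rows a = c \<longleftrightarrow> (\<Sum>s\<in>UNIV. (x $ s) *\<^sub>R (a s - c)) = 0"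
proof -
  have "(\<Sum>s\<in>UNIV. (x $ s) *\<^sub>R (a s - c)) = (\<Sum>s\<in>UNIV. (x $ s) *\<^sub>R a s) - l1_norm x *\<^sub>R c"
    by (simp add: l1_norm_nonneg_eq[OF nonneg] scaleR_diff_right sum_subtractf scaleR_left.sum)
  moreover have "(x /\<^sub>R l1_norm x) v* matrix_of_rows a
      = (\<Sum>s\<in>UNIV. (x $ s) *\<^sub>R a s) /\<^sub>R l1_norm x"
    by (simp add: vector_matrix_mult_matrix_of_rows scaleR_right.sum)
  ultimately show ?thesis
    using l1_norm_pos[OF \<open>x \<noteq> 0\<close>] by (auto simp: divideR_right)
qed

theorem theorem12p4:
  fixes a :: "'k::finite \<Rightarrow> real ^ 'n::finite"
    and w :: "real ^ 'k"
  assumes "CARD('k) > CARD('n)"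
    and "\<forall>s. w $ s > 0"
  shows "\<exists>(m::nat) (ws :: nat \<Rightarrow> real ^ 'k).
           real CARD('k) / (real CARD('n) + 1) \<le> real m \<and>
           m \<le> CARD('k) - CARD('n) \<and>
           (\<forall>i\<in>{1..m}. (\<forall>s. ws i $ s \<ge> 0) \<and>
                         1 \<le> l0_norm (ws i) \<and> l0_norm (ws i) \<le> CARD('n) + 1) \<and>
           w = (\<Sum>i=1..m. ws i) \<and>
           (\<forall>i\<in>{1..m}. (ws i /\<^sub>R l1_norm (ws i)) v* matrix_of_rows a
                         = (w /\<^sub>R l1_norm w) v* matrix_of_rows a)"
proof -
  define c where "c = (w /\<^sub>R l1_norm w) v* matrix_of_rows a"
  have w: "\<And>s. w $ s \<ge> 0" "w \<noteq> 0" "l0_norm w = CARD('k)"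
    using assms(2) by (auto simp: less_imp_le vec_eq_iff l0_norm_def less_imp_neq[symmetric])
  have "(\<Sum>s\<in>UNIV. (w $ s) *\<^sub>R (a s - c)) = 0"
    using weighted_mean_eq_iff[OF w(1,2), of a c] c_def by simp
  from annihilator_decomposition[OF w(1,2) this] obtain m ws
    where m: "m \<le> max 1 (CARD('k) - CARD('n))" and sum: "w = (\<Sum>i=1..m. ws i)"
      and ws: "\<forall>i\<in>{1..m}. (\<forall>s. ws i $ s \<ge> 0) \<and> ws i \<noteq> 0 \<and> l0_norm (ws i) \<le> CARD('n) + 1 \<and>
                 (\<Sum>s\<in>UNIV. (ws i $ s) *\<^sub>R (a s - c)) = 0"
    by (auto simp: w(3))
  have "CARD('k) \<le> (\<Sum>i=1..m. l0_norm (ws i))"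
    using l0_norm_sum_le[of ws "{1..m}"] w(3) sum by simp
  also have "\<dots> \<le> m * (CARD('n) + 1)"
    using sum_bounded_above[of "{1..m}" "\<lambda>i. l0_norm (ws i)" "CARD('n) + 1"] ws by simp
  finally have "real CARD('k) \<le> real (m * (CARD('n) + 1))"
    by (rule of_nat_mono)
  then have "real CARD('k) / (real CARD('n) + 1) \<le> real m"
    by (simp add: pos_divide_le_eq algebra_simps)
  moreover have "m \<le> CARD('k) - CARD('n)"
    using m assms(1) by simp
  moreover have "(ws i /\<^sub>R l1_norm (ws i)) v* matrix_of_rows a = c" if "i \<in> {1..m}" for i
    using ws that weighted_mean_eq_iff[of "ws i" a c] by blast
  moreover have "\<forall>i\<in>{1..m}. (\<forall>s. ws i $ s \<ge> 0) \<and>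
      1 \<le> l0_norm (ws i) \<and> l0_norm (ws i) \<le> CARD('n) + 1"
    using ws unfolding l0_norm_ge_1_iff by blast
  ultimately show ?thesis
    using sum unfolding c_def[symmetric] by blast
qed

end
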